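(* Let $G=(V_1,V_2;E)$ be an edge-colored bipartite graph with $|V_i|=n_i$ and let $\delta_i^c=\min_{v\in V_i}d^c(v)$ for $i\in\{1,2\}$. If $\delta_1^c\delta_2^c>n_1n_2/9+8n_1\sqrt{n_2}+8n_2\sqrt{n_1}$, then $G$ contains a rainbow $C_4$. Consequently, if $\delta_1^c>n_2/3+24\sqrt{n_2}$ and $\delta_2^c>n_1/3+24\sqrt{n_1}$, then $G$ contains a rainbow $C_4$.
   Context: All graphs are finite and simple. An edge-colored graph is a graph with a color assigned to each edge (not necessarily proper). $d^c(v)$ is the number of distinct colors on edges incident to $v$. A subgraph is rainbow if all its edges have pairwise distinct colors. *)

theory Defs
  imports Complex_Main
begin

text \<open>
  A finite simple graph is given by its vertex set and a set of two-element sets of vertices.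
  An edge-coloring is a function on edges; its values off the edge set are irrelevant.
\<close>

definition bipartite_graph :: "'a set \<Rightarrow> 'a set \<Rightarrow> 'a set set \<Rightarrow> bool" where
  "bipartite_graph V1 V2 E \<longleftrightarrow>
     finite V1 \<and> finite V2 \<and> V1 \<inter> V2 = {} \<and> (\<forall>e\<in>E. \<exists>x\<in>V1. \<exists>y\<in>V2. e = {x, y})"

definition color_degree :: "'a set set \<Rightarrow> ('a set \<Rightarrow> 'c) \<Rightarrow> 'a \<Rightarrow> nat" where
  "color_degree E c v = card (c ` {e \<in> E. v \<in> e})"

text \<open>The minimum over an empty set of vertices is taken to be 0.\<close>

definition min_color_degree :: "'a set set \<Rightarrow> ('a set \<Rightarrow> 'c) \<Rightarrow> 'a set \<Rightarrow> nat" where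
  "min_color_degree E c V = (if V = {} then 0 else Min (color_degree E c ` V))"

definition is_C4 :: "'a set set \<Rightarrow> bool" where
  "is_C4 F \<longleftrightarrow>
     (\<exists>w x y z. distinct [w, x, y, z] \<and> F = {{w, x}, {x, y}, {y, z}, {z, w}})"

definition rainbow :: "('a set \<Rightarrow> 'c) \<Rightarrow> 'a set set \<Rightarrow> bool" where
  "rainbow c F \<longleftrightarrow> inj_on c F"

definition has_rainbow_C4 :: "'a set set \<Rightarrow> ('a set \<Rightarrow> 'c) \<Rightarrow> bool" where
  "has_rainbow_C4 E c \<longleftrightarrow> (\<exists>F. F \<subseteq> E \<and> is_C4 F \<and> rainbow c F)"

end

theory Submission
  imports Defs "HOL-Analysis.Analysis"
begin

text \<open>
  Suppose there is no rainbow four-cycle. Every vertex \<open>v\<close> selects as many edges of pairwise distinct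
  colors as the minimum color degree of its side allows, written \<open>v \<rightarrow> u\<close>. For \<open>b, b' \<in> B\<close> the sets
  \<open>{a. b \<rightarrow> a \<and> b' \<rightarrow> a}\<close> and \<open>{a. b \<rightarrow> a \<rightarrow> b'}\<close> lie in the selection of \<open>b\<close> and almost do not overlap,
  while one of \<open>{a. b \<rightarrow> a \<rightarrow> b'}\<close>, \<open>{a. b' \<rightarrow> a \<rightarrow> b}\<close> is small on average, since otherwise two paths
  through them would form a rainbow four-cycle. Summing over all pairs \<open>(b, b')\<close> gives
  \<open>\<alpha>\<^sup>2 + 2 \<alpha> \<beta> \<le> \<alpha> + e\<close>, where \<open>\<alpha>\<close> and \<open>\<beta>\<close> are the out-degrees from \<open>B\<close> and \<open>A\<close> relative to the size
  of the opposite side and \<open>e\<close> is of order \<open>1 / sqrt |A| + 1 / sqrt |B|\<close>. By symmetry one may take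
  \<open>\<alpha> \<le> \<beta>\<close>, and then \<open>(\<alpha> - 1/3)\<^sup>2 \<ge> 0\<close> yields \<open>\<alpha> \<beta> \<le> 1/9 + 2e/3\<close>.
\<close>

lemma sum_of_bool_card: "finite X \<Longrightarrow> (\<Sum>x\<in>X. of_bool (P x)) = real (card {x \<in> X. P x})"
  by (simp add: of_bool_def sum.If_cases Int_def)

lemma inj_fiber_card:
  assumes "inj_on f X" shows "card {x \<in> X. f x = y} \<le> 1"
proof -
  have "\<And>u v. u \<in> {x \<in> X. f x = y} \<Longrightarrow> v \<in> {x \<in> X. f x = y} \<Longrightarrow> u = v"
    using assms by (auto simp: inj_on_def)
  then show ?thesis
    by (metis (no_types, lifting) One_nat_def card.infinite card_le_Suc0_iff_eq zero_le_one)
qed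

text \<open>\<open>R v u\<close> means that \<open>v\<close> selects the edge \<open>{v, u}\<close>; an edge may be selected from both of its ends.\<close>

locale color_selection =
  fixes A B :: "'a set" and E :: "'a set set" and c :: "'a set \<Rightarrow> 'c"
    and R :: "'a \<Rightarrow> 'a \<Rightarrow> bool" and dA dB :: nat
  assumes finA: "finite A" and finB: "finite B" and disj: "A \<inter> B = {}"
    and edge: "R v u \<Longrightarrow> {v, u} \<in> E"
    and bip: "R v u \<Longrightarrow> v \<in> A \<and> u \<in> B \<or> v \<in> B \<and> u \<in> A"
    and inj: "R v u \<Longrightarrow> R v u' \<Longrightarrow> c {v, u} = c {v, u'} \<Longrightarrow> u = u'"
    and degA: "a \<in> A \<Longrightarrow> card {b. R a b} = dA"
    and degB: "b \<in> B \<Longrightarrow> card {a. R b a} = dB"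
    and no_rainbow: "\<not> has_rainbow_C4 E c"
begin

text \<open>The assumptions are symmetric in the two sides, so an inequality obtained from pairs in
  \<open>B\<close> also holds for pairs in \<open>A\<close>. The final argument needs both
  versions.\<close>

lemma swap: "color_selection B A E c R dB dA"
proof
  show "R v u \<Longrightarrow> R v u' \<Longrightarrow> c {v, u} = c {v, u'} \<Longrightarrow> u = u'" for v u u' by (rule inj)
  show "R v u \<Longrightarrow> v \<in> B \<and> u \<in> A \<or> v \<in> A \<and> u \<in> B" for v u using bip by blast
qed (use finA finB disj edge degA degB no_rainbow in auto)

lemma deg_le:
  assumes "A \<noteq> {}" shows "dA \<le> card B"
proof -
  obtain a where a: "a \<in> A" using assms by blast
  then have "{b. R a b} \<subseteq> B" using bip disj by blast
  then show ?thesis using degA[OF a] card_mono[OF finB] by metis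
qed

text \<open>Neither of the paths from \<open>b\<close> to \<open>b'\<close> through \<open>a\<close>
  and through \<open>a'\<close> is monochromatic, so a repeated color must occur once on each path.
  This leaves four possible coincidences.\<close>

lemma no_rainbow_cycle:
  assumes "{b, a} \<in> E" "{a, b'} \<in> E" "{b', a'} \<in> E" "{a', b} \<in> E"
    and "a \<in> A" "a' \<in> A" "b \<in> B" "b' \<in> B" "a \<noteq> a'" "b \<noteq> b'"
    and "distinct [c {b, a}, c {a, b'}]" "distinct [c {b', a'}, c {a', b}]"
  shows "c {b, a} = c {b', a'} \<or> c {b, a} = c {a', b} \<or> c {a, b'} = c {b', a'} \<or> c {a, b'} = c {a', b}"
proof (rule ccontr)
  assume neg: "\<not> ?thesis"
  let ?F = "{{b, a}, {a, b'}, {b', a'}, {a', b}}"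
  have "distinct [b, a, b', a']" using assms disj by auto
  then have "is_C4 ?F" unfolding is_C4_def by blast
  moreover have "rainbow c ?F" unfolding rainbow_def using neg assms(11,12) by (auto simp: inj_on_def)
  moreover have "?F \<subseteq> E" using assms by auto
  ultimately show False using no_rainbow unfolding has_rainbow_C4_def by blast
qed

section \<open>Double counting over pairs of vertices of \<open>B\<close>\<close>

definition out :: "'a \<Rightarrow> 'a \<Rightarrow> real" where "out v u = of_bool (R v u)"

definition paths :: "'a \<Rightarrow> 'a \<Rightarrow> real" where
  "paths b b' = (\<Sum>a\<in>A. out b a * out a b')"

definition mono_paths :: "'a \<Rightarrow> 'a \<Rightarrow> real" where
  "mono_paths b b' = (\<Sum>a\<in>A. out b a * out a b' * of_bool (c {b, a} = c {a, b'}))"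

definition indeg :: "'a \<Rightarrow> real" where "indeg a = (\<Sum>b\<in>B. out b a)"

definition digons :: "'a \<Rightarrow> real" where "digons a = (\<Sum>b\<in>B. out a b * out b a)"

text \<open>The count ranges over all of \<open>A\<close>, non-edges included: bounding the number
  of these colors only requires that the color classes are disjoint subsets of
  \<open>A\<close>.\<close>

definition frequent_colors :: "real \<Rightarrow> 'a \<Rightarrow> 'c set" where
  "frequent_colors k b = {\<kappa>. k \<le> real (card {a \<in> A. c {a, b} = \<kappa>})}"

text \<open>The direction is \<open>b' \<rightarrow> a \<rightarrow> b\<close>, opposite to
  \<open>paths b b'\<close>; the color of the edge at \<open>b\<close> is required to be frequent at
  the other end \<open>b'\<close>.\<close>

definition frequent_paths :: "real \<Rightarrow> 'a \<Rightarrow> 'a \<Rightarrow> real" where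
  "frequent_paths k b b' = (\<Sum>a\<in>A. out b' a * out a b * of_bool (c {a, b} \<in> frequent_colors k b'))"

lemma out_bounds: "0 \<le> out v u" "out v u \<le> 1"
  by (auto simp: out_def)

lemma sum_out_B: assumes "b \<in> B" shows "(\<Sum>a\<in>A. out b a) = dB"
proof -
  have "{a \<in> A. R b a} = {a. R b a}" using bip assms disj by blast
  then show ?thesis using degB[OF assms] by (simp add: out_def sum_of_bool_card[OF finA])
qed

lemma sum_out_A: assumes "a \<in> A" shows "(\<Sum>b\<in>B. out a b) = dA"
proof -
  have "{b \<in> B. R a b} = {b. R a b}" using bip assms disj by blast
  then show ?thesis using degA[OF assms] by (simp add: out_def sum_of_bool_card[OF finB])
qed

text \<open>Both sums count vertices in the selection of \<open>b\<close>; a vertex is counted twice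
  only if it and \<open>b'\<close> select each other.\<close>

lemma paths_add_le:
  assumes "b \<in> B"
  shows "(\<Sum>a\<in>A. out b a * out b' a) + paths b b' \<le> dB + (\<Sum>a\<in>A. out b a * (out a b' * out b' a))"
proof -
  have "(\<Sum>a\<in>A. out b a * out b' a) + paths b b' =
     (\<Sum>a\<in>A. out b a * out b' a + out b a * out a b')" by (simp add: paths_def sum.distrib)
  also have "\<dots> \<le> (\<Sum>a\<in>A. out b a + out b a * (out a b' * out b' a))"
    by (rule sum_mono) (auto simp: out_def)
  finally show ?thesis by (simp add: sum.distrib sum_out_B[OF assms])
qed

lemma double_count:
  "(\<Sum>b\<in>B. \<Sum>b'\<in>B. \<Sum>a\<in>A. f a b * g a b') = (\<Sum>a\<in>A. (\<Sum>b\<in>B. f a b) * (\<Sum>b'\<in>B. g a b' :: real))"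
proof -
  have "(\<Sum>b\<in>B. \<Sum>b'\<in>B. \<Sum>a\<in>A. f a b * g a b') = (\<Sum>b\<in>B. \<Sum>a\<in>A. \<Sum>b'\<in>B. f a b * g a b')"
    by (intro sum.cong refl sum.swap)
  also have "\<dots> = (\<Sum>a\<in>A. \<Sum>b\<in>B. \<Sum>b'\<in>B. f a b * g a b')" by (rule sum.swap)
  finally show ?thesis by (simp add: sum_product)
qed

lemma sum_indeg: "(\<Sum>a\<in>A. indeg a) = card B * dB"
proof -
  have "(\<Sum>a\<in>A. indeg a) = (\<Sum>b\<in>B. \<Sum>a\<in>A. out b a)" unfolding indeg_def by (rule sum.swap)
  also have "\<dots> = (\<Sum>b\<in>B. real dB)" by (intro sum.cong refl sum_out_B)
  finally show ?thesis by simp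
qed

lemma count_inequality:
  "(\<Sum>a\<in>A. (indeg a)\<^sup>2) + 2 * (card B * dB * dA)
    \<le> (card B)\<^sup>2 * dB + 2 * (\<Sum>a\<in>A. indeg a * digons a) + (\<Sum>b\<in>B. \<Sum>b'\<in>B. min (paths b b') (paths b' b))"
proof -
  let ?D = "\<lambda>b b'. \<Sum>a\<in>A. out b a * (out a b' * out b' a)"
  let ?P = "\<lambda>b b'. \<Sum>a\<in>A. out b a * out b' a"
  have D0: "0 \<le> ?D b b'" for b b' by (intro sum_nonneg mult_nonneg_nonneg out_bounds)
  \<comment> \<open>Take \<open>paths_add_le\<close> in the direction with more paths and add the
    smaller count to both sides. The overlap term of the other direction is nonnegative and makes
    the bound symmetric.\<close>
  have pt: "?P b b' + paths b b' + paths b' b \<le> dB + ?D b b' + ?D b' b + min (paths b b') (paths b' b)"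
    if "b \<in> B" "b' \<in> B" for b b'
  proof -
    have "?P b' b = ?P b b'" by (simp add: mult.commute)
    then show ?thesis
      using paths_add_le[OF that(1), of b'] paths_add_le[OF that(2), of b] D0[of b b'] D0[of b' b]
      by (auto simp: min_def)
  qed
  have "(\<Sum>b\<in>B. \<Sum>b'\<in>B. ?P b b' + paths b b' + paths b' b)
     \<le> (\<Sum>b\<in>B. \<Sum>b'\<in>B. dB + ?D b b' + ?D b' b + min (paths b b') (paths b' b))"
    by (intro sum_mono pt)
  moreover have "(\<Sum>b\<in>B. \<Sum>b'\<in>B. ?P b b') = (\<Sum>a\<in>A. (indeg a)\<^sup>2)"
    by (subst double_count) (simp add: indeg_def power2_eq_square)
  moreover have T: "(\<Sum>b\<in>B. \<Sum>b'\<in>B. paths b b') = real (card B * dB * dA)"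
  proof -
    have "(\<Sum>b\<in>B. \<Sum>b'\<in>B. paths b b') = (\<Sum>a\<in>A. indeg a * dA)"
      unfolding paths_def by (subst double_count) (simp add: indeg_def sum_out_A)
    then show ?thesis by (simp add: sum_indeg flip: sum_distrib_right)
  qed
  moreover have "(\<Sum>b\<in>B. \<Sum>b'\<in>B. paths b' b) = real (card B * dB * dA)"
    by (subst sum.swap) (rule T)
  moreover have D: "(\<Sum>b\<in>B. \<Sum>b'\<in>B. ?D b b') = (\<Sum>a\<in>A. indeg a * digons a)"
    by (subst double_count) (simp add: indeg_def digons_def)
  moreover have "(\<Sum>b\<in>B. \<Sum>b'\<in>B. ?D b' b) = (\<Sum>a\<in>A. indeg a * digons a)"
    by (subst sum.swap) (rule D)
  ultimately show ?thesis by (simp add: sum.distrib power2_eq_square algebra_simps)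
qed

section \<open>Edges selected from both ends\<close>

text \<open>Fix one such vertex \<open>a\<close>. Any other \<open>x\<close> closes a four-cycle
  \<open>b a b' x\<close> whose vertices all select both of their cycle edges, so only opposite
  edges can share a color. Each of the two possible coincidences determines \<open>x\<close>, which
  gives \<open>1 + 1 + 1\<close>.\<close>

lemma card_common_digons:
  assumes b: "b \<in> B" "b' \<in> B" "b \<noteq> b'"
  shows "card {a \<in> A. R a b \<and> R b a \<and> R a b' \<and> R b' a} \<le> 3"
proof (cases "{a \<in> A. R a b \<and> R b a \<and> R a b' \<and> R b' a} = {}")
  case False
  define C where "C = {a \<in> A. R a b \<and> R b a \<and> R a b' \<and> R b' a}"
  have fC: "finite C" unfolding C_def using finA by simp
  obtain a where a: "a \<in> C" using False unfolding C_def by blast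
  have i: "inj_on (\<lambda>a. c {b, a}) C" "inj_on (\<lambda>a. c {b', a}) C"
    unfolding C_def using inj by (auto intro!: inj_onI)
  have "C \<subseteq> {a} \<union> {x \<in> C. c {b', x} = c {b, a}} \<union> {x \<in> C. c {b, x} = c {b', a}}"
  proof
    fix x assume x: "x \<in> C"
    show "x \<in> {a} \<union> {x \<in> C. c {b', x} = c {b, a}} \<union> {x \<in> C. c {b, x} = c {b', a}}"
    proof (cases "x = a")
      case xa: False
      have "distinct [c {b, y}, c {y, b'}]" "distinct [c {b', y}, c {y, b}]" if "y \<in> C" for y
        using that inj[of y b b'] b unfolding C_def by (auto simp: insert_commute)
      then have "c {b, a} = c {b', x} \<or> c {b, a} = c {x, b} \<or> c {a, b'} = c {b', x} \<or> c {a, b'} = c {x, b}"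
        using xa a x b edge by (intro no_rainbow_cycle) (auto simp: C_def)
      moreover have "c {b, a} \<noteq> c {x, b}" "c {a, b'} \<noteq> c {b', x}"
        using xa inj_onD[OF i(1) _ a x] inj_onD[OF i(2) _ a x] by (auto simp: insert_commute)
      ultimately show ?thesis using x by (auto simp: insert_commute)
    qed simp
  qed
  then have "card C \<le> card ({a} \<union> {x \<in> C. c {b', x} = c {b, a}} \<union> {x \<in> C. c {b, x} = c {b', a}})"
    using fC by (intro card_mono) auto
  also have "\<dots> \<le> card {a} + card {x \<in> C. c {b', x} = c {b, a}} + card {x \<in> C. c {b, x} = c {b', a}}"
    by (intro order_trans[OF card_Un_le] add_mono card_Un_le order_refl)
  also have "\<dots> \<le> 3" using inj_fiber_card[OF i(1), of "c {b', a}"] inj_fiber_card[OF i(2), of "c {b, a}"] by simp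
  finally show ?thesis by (simp add: C_def)
next
  case True
  then show ?thesis by (simp only: card.empty)
qed

lemma sum_digons_sq: "(\<Sum>a\<in>A. (digons a)\<^sup>2) \<le> card A * card B + 3 * (card B)\<^sup>2"
proof -
  let ?d = "\<lambda>a b. out a b * out b a"
  have "(\<Sum>a\<in>A. (digons a)\<^sup>2) = (\<Sum>b\<in>B. \<Sum>b'\<in>B. \<Sum>a\<in>A. ?d a b * ?d a b')"
    by (subst double_count) (simp add: digons_def power2_eq_square)
  also have "\<dots> \<le> (\<Sum>b\<in>B. \<Sum>b'\<in>B. 3 + (if b = b' then real (card A) else 0))"
  proof (intro sum_mono)
    fix b b' assume b: "b \<in> B" "b' \<in> B"
    have *: "(\<Sum>a\<in>A. ?d a b * ?d a b') = card {a \<in> A. R a b \<and> R b a \<and> R a b' \<and> R b' a}"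
      by (subst sum_of_bool_card[OF finA, symmetric]) (auto simp: out_def intro!: sum.cong)
    show "(\<Sum>a\<in>A. ?d a b * ?d a b') \<le> 3 + (if b = b' then real (card A) else 0)"
    proof (cases "b = b'")
      case True
      then show ?thesis unfolding * using card_mono[OF finA, of "{a \<in> A. R a b \<and> R b a \<and> R a b' \<and> R b' a}"]
        by auto
    next
      case False
      then show ?thesis unfolding * using card_common_digons[OF b False] by simp
    qed
  qed
  also have "\<dots> = card A * card B + 3 * (card B)\<^sup>2"
    by (simp add: sum.distrib finB power2_eq_square algebra_simps)
  finally show ?thesis by simp
qed

section \<open>Monochromatic paths and frequent colors\<close>

text \<open>Once \<open>b\<close> and \<open>a\<close> are fixed, \<open>a\<close> selects at most
  one edge of the color of \<open>{b, a}\<close>.\<close>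

lemma sum_mono_paths: "(\<Sum>b\<in>B. \<Sum>b'\<in>B. mono_paths b b') \<le> card A * card B"
proof -
  have "(\<Sum>b\<in>B. \<Sum>b'\<in>B. mono_paths b b')
     = (\<Sum>b\<in>B. \<Sum>a\<in>A. \<Sum>b'\<in>B. out b a * out a b' * of_bool (c {b, a} = c {a, b'}))"
    unfolding mono_paths_def by (intro sum.cong refl sum.swap)
  also have "\<dots> \<le> (\<Sum>b\<in>B. \<Sum>a\<in>A. 1)"
  proof (intro sum_mono)
    fix b a
    have "(\<Sum>b'\<in>B. out b a * out a b' * of_bool (c {b, a} = c {a, b'}))
       \<le> (\<Sum>b'\<in>B. of_bool (R a b' \<and> c {a, b'} = c {b, a}))"
      by (intro sum_mono) (auto simp: out_def)
    also have "\<dots> = card {b' \<in> {b'\<in>B. R a b'}. c {a, b'} = c {b, a}}"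
      by (simp add: sum_of_bool_card[OF finB] conj_assoc)
    also have "\<dots> \<le> real 1"
      using inj by (intro of_nat_mono inj_fiber_card) (auto intro!: inj_onI)
    finally show "(\<Sum>b'\<in>B. out b a * out a b' * of_bool (c {b, a} = c {a, b'})) \<le> 1" by simp
  qed
  finally show ?thesis by (simp add: mult.commute)
qed

lemma frequent_colors_bound:
  assumes k: "k > 0"
  shows "finite (frequent_colors k b)" "card (frequent_colors k b) \<le> card A / k"
proof -
  let ?f = "\<lambda>\<kappa>. {a \<in> A. c {a, b} = \<kappa>}"
  have "frequent_colors k b \<subseteq> (\<lambda>a. c {a, b}) ` A"
  proof
    fix \<kappa> assume "\<kappa> \<in> frequent_colors k b"
    then have "?f \<kappa> \<noteq> {}" using k unfolding frequent_colors_def by (auto simp del: Collect_empty_eq)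
    then show "\<kappa> \<in> (\<lambda>a. c {a, b}) ` A" by blast
  qed
  then show fin: "finite (frequent_colors k b)" using finA finite_subset by blast
  have "card (frequent_colors k b) * k \<le> (\<Sum>\<kappa>\<in>frequent_colors k b. real (card (?f \<kappa>)))"
    using sum_mono[of "frequent_colors k b" "\<lambda>_. k" "\<lambda>\<kappa>. real (card (?f \<kappa>))"]
    by (simp add: frequent_colors_def)
  also have "\<dots> = real (card (\<Union>\<kappa>\<in>frequent_colors k b. ?f \<kappa>))"
    using fin finA by (subst card_UN_disjoint) auto
  also have "\<dots> \<le> card A" by (intro of_nat_mono card_mono finA) auto
  finally show "card (frequent_colors k b) \<le> card A / k" using k by (simp add: field_simps)
qed

text \<open>For fixed \<open>b'\<close> and \<open>a\<close>, the edges selected by \<open>a\<close>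
  have distinct colors, so the number of possible ends \<open>b\<close> is at most the number of
  colors frequent at \<open>b'\<close>.\<close>

lemma sum_frequent_paths:
  assumes k: "k > 0"
  shows "(\<Sum>b\<in>B. \<Sum>b'\<in>B. frequent_paths k b b') \<le> (card A)\<^sup>2 * card B / k"
proof -
  have "(\<Sum>b\<in>B. \<Sum>b'\<in>B. frequent_paths k b b') = (\<Sum>b'\<in>B. \<Sum>b\<in>B. frequent_paths k b b')"
    by (rule sum.swap)
  also have "\<dots> = (\<Sum>b'\<in>B. \<Sum>a\<in>A. \<Sum>b\<in>B. out b' a * out a b * of_bool (c {a, b} \<in> frequent_colors k b'))"
    unfolding frequent_paths_def by (intro sum.cong refl sum.swap)
  also have "\<dots> \<le> (\<Sum>b'\<in>B. \<Sum>a\<in>A. card A / k)"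
  proof (intro sum_mono)
    fix b' a
    let ?X = "{b \<in> B. R a b \<and> c {a, b} \<in> frequent_colors k b'}"
    have "(\<Sum>b\<in>B. out b' a * out a b * of_bool (c {a, b} \<in> frequent_colors k b'))
       \<le> (\<Sum>b\<in>B. of_bool (R a b \<and> c {a, b} \<in> frequent_colors k b'))"
      by (intro sum_mono) (auto simp: out_def)
    also have "\<dots> = card ?X" by (rule sum_of_bool_card[OF finB])
    also have "\<dots> \<le> card (frequent_colors k b')"
      using inj frequent_colors_bound(1)[OF k]
      by (intro of_nat_mono card_inj_on_le[where f = "\<lambda>b. c {a, b}"]) (auto intro!: inj_onI)
    also have "\<dots> \<le> card A / k" by (rule frequent_colors_bound(2)[OF k])
    finally show "(\<Sum>b\<in>B. out b' a * out a b * of_bool (c {a, b} \<in> frequent_colors k b')) \<le> card A / k" .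
  qed
  finally show ?thesis by (simp add: power2_eq_square algebra_simps)
qed

text \<open>
  For each \<open>a' \<in> T\<close>, all but two \<open>a \<in> S\<close> have \<open>c {a, b'}\<close> among the two colors of the path through \<open>a'\<close>.
  Hence one color \<open>\<kappa>\<close> is used on at least \<open>k\<close> edges from \<open>S\<close> to \<open>b'\<close>, and then all but one \<open>a' \<in> T\<close> have
  \<open>c {a', b} = \<kappa>\<close>, because \<open>b'\<close> selects only one edge of color \<open>\<kappa>\<close>.
\<close>

lemma dominant_color:
  assumes b: "b \<in> B" "b' \<in> B" "b \<noteq> b'" and k: "k \<ge> 3"
    and S: "S = {a \<in> A. R b a \<and> R a b' \<and> c {b, a} \<noteq> c {a, b'}}"
    and T: "T = {a \<in> A. R b' a \<and> R a b \<and> c {b', a} \<noteq> c {a, b}}"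
    and large: "2 * k + 2 \<le> real (card S)"
  shows "card T \<le> 1 + card {a \<in> A. R b' a \<and> R a b \<and> c {a, b} \<in> frequent_colors k b'}"
proof (cases "T = {}")
  case False
  have fS: "finite S" and fT: "finite T" using S T finA by auto
  have iS: "inj_on (\<lambda>a. c {b, a}) S" and iT: "inj_on (\<lambda>a. c {b', a}) T"
    using S T inj by (auto intro!: inj_onI)
  have clash: "c {b, a} = c {b', a'} \<or> c {b, a} = c {a', b} \<or> c {a, b'} = c {b', a'} \<or> c {a, b'} = c {a', b}"
    if "a \<in> S" "a' \<in> T" for a a'
  proof (cases "a = a'")
    case True
    then show ?thesis by (simp add: insert_commute)
  next
    case False
    then show ?thesis using that b edge by (intro no_rainbow_cycle) (auto simp: S T)
  qed
  have two: "card {a \<in> S. c {b, a} = p \<or> c {b, a} = q} \<le> 2" for p q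
  proof -
    have eq: "{a \<in> S. c {b, a} = p \<or> c {b, a} = q} = {a \<in> S. c {b, a} = p} \<union> {a \<in> S. c {b, a} = q}" by blast
    show ?thesis
      unfolding eq using inj_fiber_card[OF iS, of p] inj_fiber_card[OF iS, of q]
        card_Un_le[of "{a \<in> S. c {b, a} = p}" "{a \<in> S. c {b, a} = q}"] by linarith
  qed
  let ?Y = "\<lambda>\<kappa>. {a \<in> S. c {a, b'} = \<kappa>}"
  \<comment> \<open>Of the at least \<open>2 * k + 2\<close> vertices of \<open>S\<close>, at most
    two clash with \<open>a'\<close> through their edge to \<open>b\<close>; the others are divided
    between two colors at \<open>b'\<close>.\<close>
  obtain \<kappa> where \<kappa>: "k \<le> real (card (?Y \<kappa>))"
  proof -
    obtain a' where a': "a' \<in> T" using False by blast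
    let ?p = "c {b', a'}" and ?q = "c {a', b}"
    have "S \<subseteq> {a \<in> S. c {b, a} = ?p \<or> c {b, a} = ?q} \<union> (?Y ?p \<union> ?Y ?q)"
      using clash[OF _ a'] by blast
    then have "card S \<le> card ({a \<in> S. c {b, a} = ?p \<or> c {b, a} = ?q} \<union> (?Y ?p \<union> ?Y ?q))"
      using fS by (intro card_mono) auto
    also have "\<dots> \<le> card {a \<in> S. c {b, a} = ?p \<or> c {b, a} = ?q} + (card (?Y ?p) + card (?Y ?q))"
      by (intro order_trans[OF card_Un_le] add_mono card_Un_le order_refl)
    finally have "real (card S) \<le> 2 + real (card (?Y ?p)) + real (card (?Y ?q))" using two[of ?p ?q] by linarith
    with large have "k \<le> real (card (?Y ?p)) \<or> k \<le> real (card (?Y ?q))" by linarith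
    then show thesis using that by blast
  qed
  have freq: "\<kappa> \<in> frequent_colors k b'"
  proof -
    have "card (?Y \<kappa>) \<le> card {a \<in> A. c {a, b'} = \<kappa>}" using S finA by (intro card_mono) auto
    then show ?thesis using \<kappa> unfolding frequent_colors_def by simp
  qed
  let ?F = "{a \<in> A. R b' a \<and> R a b \<and> c {a, b} \<in> frequent_colors k b'}"
  have "T \<subseteq> {a' \<in> T. c {b', a'} = \<kappa>} \<union> ?F"
  proof
    fix a' assume a': "a' \<in> T"
    let ?Z = "{a \<in> S. c {b, a} = c {b', a'} \<or> c {b, a} = c {a', b}}"
    \<comment> \<open>At most two vertices of \<open>S\<close> lie in \<open>?Z\<close>, so
      \<open>k \<ge> 3\<close> leaves some \<open>a\<close> outside it, whose clash with
      \<open>a'\<close> must involve \<open>\<kappa>\<close>.\<close>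
    have "\<not> ?Y \<kappa> \<subseteq> ?Z"
    proof
      assume "?Y \<kappa> \<subseteq> ?Z"
      then have "card (?Y \<kappa>) \<le> card ?Z" using fS by (intro card_mono) auto
      then show False using two[of "c {b', a'}" "c {a', b}"] \<kappa> k by linarith
    qed
    then obtain a where a: "a \<in> S" "c {a, b'} = \<kappa>" "\<not> (c {b, a} = c {b', a'} \<or> c {b, a} = c {a', b})"
      by blast
    then have "\<kappa> = c {b', a'} \<or> \<kappa> = c {a', b}" using clash[OF a(1) a'] by blast
    then show "a' \<in> {a' \<in> T. c {b', a'} = \<kappa>} \<union> ?F" using a' freq T by auto
  qed
  then have "card T \<le> card ({a' \<in> T. c {b', a'} = \<kappa>} \<union> ?F)"
    using fT finA by (intro card_mono) auto
  then show ?thesis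
    using inj_fiber_card[OF iT, of \<kappa>] card_Un_le[of "{a' \<in> T. c {b', a'} = \<kappa>}" ?F] by linarith
qed simp

text \<open>Either few paths \<open>b \<rightarrow> a \<rightarrow> b'\<close> are
  non-monochromatic, or \<open>dominant_color\<close> forces nearly all non-monochromatic paths back
  to be frequent ones. For \<open>b = b'\<close> both edges of a path coincide, so every path is
  monochromatic.\<close>

lemma min_paths_le:
  assumes b: "b \<in> B" "b' \<in> B" and k: "k \<ge> 3"
  shows "min (paths b b') (paths b' b) \<le> mono_paths b b' + mono_paths b' b + (2 * k + 2) + frequent_paths k b b'"
proof -
  define S where "S x y = {a \<in> A. R x a \<and> R a y \<and> c {x, a} \<noteq> c {a, y}}" for x y
  have split: "paths x y = mono_paths x y + card (S x y)" for x y
  proof -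
    have "paths x y = (\<Sum>a\<in>A. out x a * out a y * of_bool (c {x, a} = c {a, y})
        + of_bool (R x a \<and> R a y \<and> c {x, a} \<noteq> c {a, y}))"
      unfolding paths_def by (intro sum.cong) (auto simp: out_def)
    then show ?thesis by (simp add: sum.distrib mono_paths_def sum_of_bool_card[OF finA] S_def)
  qed
  have m0: "0 \<le> mono_paths x y" for x y
    unfolding mono_paths_def by (intro sum_nonneg) (auto simp: out_def)
  have f: "frequent_paths k b b' = card {a \<in> A. R b' a \<and> R a b \<and> c {a, b} \<in> frequent_colors k b'}"
    unfolding frequent_paths_def
    by (subst sum_of_bool_card[OF finA, symmetric]) (auto simp: out_def intro!: sum.cong)
  show ?thesis
  proof (cases "b = b'")
    case True
    then have "S b b' = {}" by (auto simp: S_def insert_commute)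
    then show ?thesis using split[of b b'] m0[of b b'] m0[of b' b] k True f by simp
  next
    case False
    show ?thesis
    proof (cases "2 * k + 2 \<le> real (card (S b b'))")
      case True
      have "real (card (S b' b)) \<le> 1 + frequent_paths k b b'"
        using dominant_color[OF b False k S_def S_def True] unfolding f by linarith
      then show ?thesis using split[of b' b] m0[of b b'] k by linarith
    next
      case False
      then show ?thesis using split[of b b'] m0[of b' b] f by linarith
    qed
  qed
qed

lemma sum_min_paths:
  fixes k :: real
  assumes k: "k \<ge> 3"
  shows "(\<Sum>b\<in>B. \<Sum>b'\<in>B. min (paths b b') (paths b' b))
     \<le> 2 * (card A * card B) + (2 * k + 2) * (card B)\<^sup>2 + (card A)\<^sup>2 * card B / k"
proof -
  have "(\<Sum>b\<in>B. \<Sum>b'\<in>B. min (paths b b') (paths b' b))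
     \<le> (\<Sum>b\<in>B. \<Sum>b'\<in>B. mono_paths b b' + mono_paths b' b + (2 * k + 2) + frequent_paths k b b')"
    by (intro sum_mono min_paths_le k)
  also have "\<dots> = (\<Sum>b\<in>B. \<Sum>b'\<in>B. mono_paths b b') + (\<Sum>b\<in>B. \<Sum>b'\<in>B. mono_paths b' b)
     + (2 * k + 2) * (card B)\<^sup>2 + (\<Sum>b\<in>B. \<Sum>b'\<in>B. frequent_paths k b b')"
    by (simp add: sum.distrib power2_eq_square algebra_simps)
  also have "(\<Sum>b\<in>B. \<Sum>b'\<in>B. mono_paths b' b) = (\<Sum>b\<in>B. \<Sum>b'\<in>B. mono_paths b b')"
    by (rule sum.swap)
  finally show ?thesis using sum_mono_paths sum_frequent_paths[of k] k by simp
qed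

section \<open>The inequality for relative out-degrees\<close>

lemma sum_indeg_digons:
  "(\<Sum>a\<in>A. indeg a * digons a) \<le> card B * (card A * sqrt (card B) + 2 * card B * sqrt (card A))"
proof -
  have d0: "0 \<le> digons a" for a unfolding digons_def by (intro sum_nonneg) (auto simp: out_def)
  have "(\<Sum>a\<in>A. digons a)\<^sup>2 \<le> card A * (\<Sum>a\<in>A. (digons a)\<^sup>2)"
    using Cauchy_Schwarz_ineq_sum[of "\<lambda>_. 1" digons A] by simp
  also have "\<dots> \<le> real (card A) * real (card A * card B + 3 * (card B)\<^sup>2)"
    using sum_digons_sq by (intro mult_left_mono) auto
  \<comment> \<open>Expanding the square gives the coefficient \<open>4\<close> in place of
    \<open>3\<close>, and a nonnegative mixed term.\<close>
  also have "\<dots> \<le> (card A * sqrt (card B) + 2 * card B * sqrt (card A))\<^sup>2"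
    by (simp add: power2_sum power_mult_distrib algebra_simps) (simp add: power2_eq_square)
  finally have d: "(\<Sum>a\<in>A. digons a) \<le> card A * sqrt (card B) + 2 * card B * sqrt (card A)"
    by (rule power2_le_imp_le) simp
  have "indeg a \<le> card B" for a
    unfolding indeg_def using sum_bounded_above[of B "\<lambda>b. out b a" 1] out_bounds by simp
  then have "(\<Sum>a\<in>A. indeg a * digons a) \<le> (\<Sum>a\<in>A. card B * digons a)"
    by (intro sum_mono mult_right_mono d0)
  also have "\<dots> = card B * (\<Sum>a\<in>A. digons a)" by (rule sum_distrib_left[symmetric])
  also have "\<dots> \<le> card B * (card A * sqrt (card B) + 2 * card B * sqrt (card A))"
    by (intro mult_left_mono d) simp
  finally show ?thesis .
qed

lemma key_inequality:
  fixes s t \<alpha> \<beta> :: real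
  defines "s \<equiv> sqrt (card A)" and "t \<equiv> sqrt (card B)"
    and "\<alpha> \<equiv> dB / card A" and "\<beta> \<equiv> dA / card B"
  assumes s: "s \<ge> 8" and t: "t \<ge> 8"
  shows "\<alpha>\<^sup>2 + 2 * \<alpha> * \<beta> \<le> \<alpha> + 12 / s + 12 / t"
proof -
  \<comment> \<open>The threshold \<open>card A / sqrt (card B)\<close> balances the terms \<open>k * (card B)\<^sup>2\<close> and \<open>(card A)\<^sup>2 * card B / k\<close>.\<close>
  define k where "k = s\<^sup>2 / t + 3"
  have A: "real (card A) = s\<^sup>2" and B: "real (card B) = t\<^sup>2" by (simp_all add: s_def t_def)
  have pos: "s > 0" "t > 0" "s\<^sup>2 / t > 0" using s t by auto
  have k3: "k \<ge> 3" using pos by (simp add: k_def)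
  have dB: "real dB = \<alpha> * s\<^sup>2" and dA: "real dA = \<beta> * t\<^sup>2"
    using pos by (simp_all add: \<alpha>_def \<beta>_def A B)
  have "(\<Sum>a\<in>A. indeg a)\<^sup>2 \<le> card A * (\<Sum>a\<in>A. (indeg a)\<^sup>2)"
    using Cauchy_Schwarz_ineq_sum[of "\<lambda>_. 1" indeg A] by simp
  then have "s\<^sup>2 * (s\<^sup>2 * t\<^sup>2 * t\<^sup>2 * \<alpha>\<^sup>2) \<le> s\<^sup>2 * (\<Sum>a\<in>A. (indeg a)\<^sup>2)"
    unfolding sum_indeg by (simp add: A B dB power2_eq_square algebra_simps)
  then have sq: "s\<^sup>2 * t\<^sup>2 * t\<^sup>2 * \<alpha>\<^sup>2 \<le> (\<Sum>a\<in>A. (indeg a)\<^sup>2)"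
    by (rule mult_left_le_imp_le) (use pos in simp)
  have freq: "(s\<^sup>2)\<^sup>2 * t\<^sup>2 / k \<le> s\<^sup>2 * t\<^sup>2 * t"
  proof -
    have "(s\<^sup>2)\<^sup>2 * t\<^sup>2 / k \<le> (s\<^sup>2)\<^sup>2 * t\<^sup>2 / (s\<^sup>2 / t)"
      using pos by (intro divide_left_mono mult_pos_pos) (auto simp: k_def intro: add_pos_pos)
    then show ?thesis using pos by (simp add: power2_eq_square)
  qed
  have "s\<^sup>2 * t\<^sup>2 * t\<^sup>2 * \<alpha>\<^sup>2 + 2 * (t\<^sup>2 * (\<alpha> * s\<^sup>2) * (\<beta> * t\<^sup>2))
    \<le> (t\<^sup>2)\<^sup>2 * (\<alpha> * s\<^sup>2) + 2 * (t\<^sup>2 * (s\<^sup>2 * t + 2 * t\<^sup>2 * s))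
      + (2 * (s\<^sup>2 * t\<^sup>2) + (2 * k + 2) * (t\<^sup>2)\<^sup>2 + s\<^sup>2 * t\<^sup>2 * t)"
    using count_inequality sum_indeg_digons sum_min_paths[OF k3] sq freq pos(1,2)
    by (simp add: A B dA dB flip: s_def t_def)
  \<comment> \<open>In \<open>5 / t\<close>, the digons and the threshold \<open>k\<close>
    contribute \<open>2\<close> each and the frequent colors \<open>1\<close>;
    \<open>8 / s\<^sup>2\<close> comes from the \<open>3\<close> in \<open>k\<close> and the
    \<open>2\<close> in \<open>2 * k + 2\<close>.\<close>
  also have "\<dots> = s\<^sup>2 * (t\<^sup>2)\<^sup>2 * (\<alpha> + 5 / t + 2 / t\<^sup>2 + 4 / s + 8 / s\<^sup>2)"
    using pos by (simp add: k_def field_simps power2_eq_square)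
  finally have "s\<^sup>2 * (t\<^sup>2)\<^sup>2 * (\<alpha>\<^sup>2 + 2 * \<alpha> * \<beta>) \<le> s\<^sup>2 * (t\<^sup>2)\<^sup>2 * (\<alpha> + 5 / t + 2 / t\<^sup>2 + 4 / s + 8 / s\<^sup>2)"
    by (simp add: power2_eq_square algebra_simps)
  then have "\<alpha>\<^sup>2 + 2 * \<alpha> * \<beta> \<le> \<alpha> + 5 / t + 2 / t\<^sup>2 + 4 / s + 8 / s\<^sup>2"
    using pos by simp
  moreover have "2 / t\<^sup>2 \<le> 7 / t" "8 / s\<^sup>2 \<le> 8 / s"
    using s t by (simp_all add: field_simps power2_eq_square)
  ultimately show ?thesis by (simp add: add_divide_distrib[symmetric])
qed

end

section \<open>Choosing the selections\<close>

text \<open>Pick \<open>d\<close> of the colors at \<open>v\<close> and one edge at \<open>v\<close>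
  for each of them.\<close>

lemma selection_exists:
  assumes "bipartite_graph V1 V2 E" "v \<in> V1" "d \<le> color_degree E c v"
  shows "\<exists>U \<subseteq> V2. (\<forall>u\<in>U. {v, u} \<in> E) \<and> inj_on (\<lambda>u. c {v, u}) U \<and> card U = d"
proof -
  let ?N = "{u \<in> V2. {v, u} \<in> E}"
  have sub: "c ` {e \<in> E. v \<in> e} \<subseteq> (\<lambda>u. c {v, u}) ` ?N"
  proof
    fix \<kappa> assume "\<kappa> \<in> c ` {e \<in> E. v \<in> e}"
    then obtain e where e: "e \<in> E" "v \<in> e" "\<kappa> = c e" by blast
    then obtain x y where "x \<in> V1" "y \<in> V2" "e = {x, y}"
      using assms(1) unfolding bipartite_graph_def by blast
    moreover have "v \<noteq> y" using assms(1,2) \<open>y \<in> V2\<close> unfolding bipartite_graph_def by blast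
    ultimately show "\<kappa> \<in> (\<lambda>u. c {v, u}) ` ?N" using e by auto
  qed
  obtain K where K: "K \<subseteq> c ` {e \<in> E. v \<in> e}" "card K = d"
    by (rule obtain_subset_with_card_n[OF assms(3)[unfolded color_degree_def]])
  obtain U where U: "U \<subseteq> ?N" "inj_on (\<lambda>u. c {v, u}) U" "K = (\<lambda>u. c {v, u}) ` U"
    using subset_image_inj[THEN iffD1, OF subset_trans[OF K(1) sub]] by blast
  then have "card U = d" using K(2) card_image[OF U(2)] by (simp only:)
  with U(1,2) show ?thesis by (intro exI[of _ U]) blast
qed

lemma bipartite_graph_sym: "bipartite_graph V1 V2 E \<Longrightarrow> bipartite_graph V2 V1 E"
  unfolding bipartite_graph_def by (metis Int_commute insert_commute)

lemma min_color_degree_le: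
  "finite V \<Longrightarrow> v \<in> V \<Longrightarrow> min_color_degree E c V \<le> color_degree E c v"
  unfolding min_color_degree_def by auto

lemma color_selection_exists:
  assumes G: "bipartite_graph V1 V2 E" and nr: "\<not> has_rainbow_C4 E c"
  shows "\<exists>R. color_selection V1 V2 E c R (min_color_degree E c V1) (min_color_degree E c V2)"
proof -
  have fin: "finite V1" "finite V2" and disj: "V1 \<inter> V2 = {}" using G by (auto simp: bipartite_graph_def)
  obtain U1 where U1: "\<And>v. v \<in> V1 \<Longrightarrow> U1 v \<subseteq> V2 \<and> (\<forall>u\<in>U1 v. {v, u} \<in> E)
      \<and> inj_on (\<lambda>u. c {v, u}) (U1 v) \<and> card (U1 v) = min_color_degree E c V1"
    using selection_exists[OF G _ min_color_degree_le[OF fin(1)]] by metis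
  obtain U2 where U2: "\<And>v. v \<in> V2 \<Longrightarrow> U2 v \<subseteq> V1 \<and> (\<forall>u\<in>U2 v. {v, u} \<in> E)
      \<and> inj_on (\<lambda>u. c {v, u}) (U2 v) \<and> card (U2 v) = min_color_degree E c V2"
    using selection_exists[OF bipartite_graph_sym[OF G] _ min_color_degree_le[OF fin(2)]] by metis
  define R where "R v u \<longleftrightarrow> v \<in> V1 \<and> u \<in> U1 v \<or> v \<in> V2 \<and> u \<in> U2 v" for v u
  have R1: "{u. R v u} = U1 v" if "v \<in> V1" for v using that disj unfolding R_def by blast
  have R2: "{u. R v u} = U2 v" if "v \<in> V2" for v using that disj unfolding R_def by blast
  have "color_selection V1 V2 E c R (min_color_degree E c V1) (min_color_degree E c V2)"
  proof
    show "R v u \<Longrightarrow> R v u' \<Longrightarrow> c {v, u} = c {v, u'} \<Longrightarrow> u = u'" for v u u'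
      using U1[of v] U2[of v] disj unfolding R_def inj_on_def by blast
    show "R v u \<Longrightarrow> v \<in> V1 \<and> u \<in> V2 \<or> v \<in> V2 \<and> u \<in> V1" for v u
      using U1[of v] U2[of v] unfolding R_def by blast
    show "R v u \<Longrightarrow> {v, u} \<in> E" for v u
      using U1[of v] U2[of v] unfolding R_def by blast
  qed (use fin disj nr U1 U2 R1 R2 in simp_all)
  then show ?thesis by blast
qed

section \<open>From the inequality to a rainbow four-cycle\<close>

text \<open>The square gives \<open>\<alpha> \<le> 3/2 * \<alpha>\<^sup>2 + 1/6\<close>, hence
  \<open>2 * \<alpha> * \<beta> \<le> \<alpha>\<^sup>2 / 2 + 1/6 + e\<close>. Replacing
  \<open>\<alpha>\<^sup>2\<close> by \<open>\<alpha> * \<beta>\<close> leaves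
  \<open>3/2 * \<alpha> * \<beta> \<le> 1/6 + e\<close>.\<close>

lemma product_bound:
  fixes \<alpha> \<beta> e :: real
  assumes "\<alpha>\<^sup>2 + 2 * \<alpha> * \<beta> \<le> \<alpha> + e" and "0 \<le> \<alpha>" "\<alpha> \<le> \<beta>"
  shows "\<alpha> * \<beta> \<le> 1 / 9 + 2 / 3 * e"
proof -
  have "0 \<le> (\<alpha> - 1 / 3)\<^sup>2" by simp
  moreover have "\<alpha>\<^sup>2 \<le> \<alpha> * \<beta>" using assms by (simp add: power2_eq_square mult_left_mono)
  ultimately show ?thesis using assms(1) by (simp add: power2_diff field_simps)
qed

theorem theorem4p5:
  fixes V1 V2 :: "'a set" and E :: "'a set set" and c :: "'a set \<Rightarrow> 'c"
    and n1 n2 \<delta>1 \<delta>2 :: nat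
  assumes "bipartite_graph V1 V2 E"
    and "n1 = card V1" and "n2 = card V2"
    and "\<delta>1 = min_color_degree E c V1" and "\<delta>2 = min_color_degree E c V2"
  shows "(real \<delta>1 * real \<delta>2 >
            real n1 * real n2 / 9 + 8 * real n1 * sqrt (real n2) + 8 * real n2 * sqrt (real n1)
          \<longrightarrow> has_rainbow_C4 E c)
       \<and> (real \<delta>1 > real n2 / 3 + 24 * sqrt (real n2) \<and>
          real \<delta>2 > real n1 / 3 + 24 * sqrt (real n1)
          \<longrightarrow> has_rainbow_C4 E c)"
proof -
  have main: "has_rainbow_C4 E c"
    if large: "real \<delta>1 * real \<delta>2 >
       real n1 * real n2 / 9 + 8 * real n1 * sqrt (real n2) + 8 * real n2 * sqrt (real n1)"
  proof (rule ccontr)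
    assume nr: "\<not> has_rainbow_C4 E c"
    obtain R where R: "color_selection V1 V2 E c R \<delta>1 \<delta>2"
      using color_selection_exists[OF assms(1) nr] assms by blast
    have fin: "finite V1" "finite V2" using assms(1) by (auto simp: bipartite_graph_def)
    have "0 < real \<delta>1 * real \<delta>2" by (rule le_less_trans[OF _ large]) simp
    \<comment> \<open>An empty side would have minimum color degree \<open>0\<close> by
      convention.\<close>
    then have "V1 \<noteq> {}" "V2 \<noteq> {}" using assms(4,5) by (auto simp: min_color_degree_def)
    then have n: "real n1 > 0" "real n2 > 0" using fin assms(2,3) by (auto simp: card_gt_0_iff)
    have le: "\<delta>1 \<le> n2" "\<delta>2 \<le> n1"
      using color_selection.deg_le[OF R] color_selection.deg_le[OF color_selection.swap[OF R]]
        \<open>V1 \<noteq> {}\<close> \<open>V2 \<noteq> {}\<close> assms(2,3) by simp_all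
    define s t \<alpha> \<beta> where "s = sqrt n1" and "t = sqrt n2" and "\<alpha> = \<delta>2 / n1" and "\<beta> = \<delta>1 / n2"
    have st: "s > 0" "t > 0" "s\<^sup>2 = n1" "t\<^sup>2 = n2" using n by (simp_all add: s_def t_def)
    have ab: "0 \<le> \<alpha>" "\<alpha> \<le> 1" "0 \<le> \<beta>" "\<beta> \<le> 1" using le n by (simp_all add: \<alpha>_def \<beta>_def)
    have d: "real \<delta>2 = \<alpha> * s\<^sup>2" "real \<delta>1 = \<beta> * t\<^sup>2" using n st by (simp_all add: \<alpha>_def \<beta>_def)
    have "s\<^sup>2 * t\<^sup>2 * (1 / 9 + 8 / s + 8 / t) = n1 * n2 / 9 + 8 * n1 * sqrt n2 + 8 * n2 * sqrt n1"
      unfolding s_def[symmetric] t_def[symmetric] of_nat_mult st(3,4)[symmetric] using st(1,2)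
      by (simp add: field_simps power2_eq_square)
    also have "\<dots> < s\<^sup>2 * t\<^sup>2 * (\<alpha> * \<beta>)"
      using large by (simp add: d mult_ac)
    finally have "s\<^sup>2 * t\<^sup>2 * (1 / 9 + 8 / s + 8 / t) < s\<^sup>2 * t\<^sup>2 * (\<alpha> * \<beta>)" .
    then have big: "1 / 9 + 8 / s + 8 / t < \<alpha> * \<beta>" using st(1,2) by simp
    \<comment> \<open>The lower bound \<open>big\<close> can only be met below \<open>1\<close> if
      both sides are large, which supplies the assumptions \<open>s \<ge> 8\<close> and
      \<open>t \<ge> 8\<close> of \<open>key_inequality\<close>.\<close>
    have "\<alpha> * \<beta> \<le> 1" using ab by (simp add: mult_le_one)
    moreover have "0 < 8 / s" "0 < 8 / t" using st by auto
    ultimately have "8 / s \<le> 1" "8 / t \<le> 1" using big by linarith+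
    then have st8: "s \<ge> 8" "t \<ge> 8" using st by (simp_all add: field_simps)
    have e: "2 / 3 * (12 / s + 12 / t) = 8 / s + 8 / t" "2 / 3 * (12 / t + 12 / s) = 8 / s + 8 / t" by simp_all
    have "\<alpha>\<^sup>2 + 2 * \<alpha> * \<beta> \<le> \<alpha> + (12 / s + 12 / t)"
      using color_selection.key_inequality[OF R] st8 assms(2,3) by (simp add: s_def t_def \<alpha>_def \<beta>_def)
    then have 1: "\<alpha> \<le> \<beta> \<Longrightarrow> \<alpha> * \<beta> \<le> 1 / 9 + 2 / 3 * (12 / s + 12 / t)"
      using ab(1) by (rule product_bound)
    have "\<beta>\<^sup>2 + 2 * \<beta> * \<alpha> \<le> \<beta> + (12 / t + 12 / s)"
      using color_selection.key_inequality[OF color_selection.swap[OF R]] st8 assms(2,3)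
      by (simp add: s_def t_def \<alpha>_def \<beta>_def)
    then have 2: "\<beta> \<le> \<alpha> \<Longrightarrow> \<beta> * \<alpha> \<le> 1 / 9 + 2 / 3 * (12 / t + 12 / s)"
      using ab(3) by (rule product_bound)
    have "\<alpha> * \<beta> \<le> 1 / 9 + (8 / s + 8 / t)"
      using 1 2 linear[of \<alpha> \<beta>] unfolding e mult.commute[of \<beta> \<alpha>] by blast
    with big show False by simp
  qed
  moreover have "real n1 * real n2 / 9 + 8 * real n1 * sqrt (real n2) + 8 * real n2 * sqrt (real n1)
       < real \<delta>1 * real \<delta>2"
    if "real \<delta>1 > real n2 / 3 + 24 * sqrt (real n2)" "real \<delta>2 > real n1 / 3 + 24 * sqrt (real n1)"
  proof -
    have "(real n2 / 3 + 24 * sqrt (real n2)) * (real n1 / 3 + 24 * sqrt (real n1)) < real \<delta>1 * real \<delta>2"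
    proof (intro mult_strict_mono that)
      show "0 < real \<delta>1" by (rule le_less_trans[OF _ that(1)]) simp
    qed simp
    moreover have "0 \<le> sqrt n1 * sqrt n2" by simp
    \<comment> \<open>The mixed products have coefficient \<open>24 / 3 = 8\<close>, as required;
      the last product is a nonnegative surplus.\<close>
    moreover have "(real n2 / 3 + 24 * sqrt (real n2)) * (real n1 / 3 + 24 * sqrt (real n1)) =
        real n1 * real n2 / 9 + 8 * real n1 * sqrt (real n2) + 8 * real n2 * sqrt (real n1)
        + 576 * (sqrt n1 * sqrt n2)" by (simp add: algebra_simps)
    ultimately show ?thesis by linarith
  qed
  ultimately show ?thesis by blast
qed

end
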